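(* Let $G_0$ be a finite plane cubic simple graph with face set $\mathcal{F}_{G_0}$, let $\mathcal{P}\subsetneq\mathcal{F}_{G_0}$ be a perforated patch, and let $G=G(\mathcal{P})$ be its skeleton. Suppose the holes of $\mathcal{P}$ have perimeters $C_1,\dots,C_k$ forming an admissible structure $(G;C_1,\dots,C_k)$, and let $K$ be the number of Kekul\'e structures of $G$. Let $\mathbf{n}=(n_1,\dots,n_k)$ be a vector of non-negative integers and $G'=A^{\mathbf{n}}(G;C_1,\dots,C_k)$. Then the number $K'$ of Kekul\'e structures of $G'$ is $K'=2^{|\mathbf{n}|}K$, where $|\mathbf{n}|=n_1+\cdots+n_k$. Furthermore: (a) no spoke belongs to any Kekul\'e structure of $G'$; (b) if $n_i>0$, every edge of the new perimeter replacing $C_i$ (the cycle created by the last altan operation performed at position $i$) belongs to exactly $K'/2$ Kekul\'e structures of $G'$.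
   Context: A Kekul\'e structure of a graph is a perfect matching. Faces of a plane graph are adjacent if they are distinct and share an edge. For a set $\mathcal{P}$ of faces, $a\equiv_{\mathcal{P}}b$ if there is a sequence $a=c_0,c_1,\dots,c_m=b$ of faces of $\mathcal{P}$ with $c_{i-1}$ adjacent to $c_i$; $\mathcal{P}$ is connected if it is non-empty and has one equivalence class. A perforated patch is a connected proper subset $\mathcal{P}\subsetneq\mathcal{F}_{G_0}$; its skeleton $G(\mathcal{P})$ is the subgraph of $G_0$ consisting of all vertices and edges lying on the boundary of at least one face of $\mathcal{P}$. The holes of $\mathcal{P}$ are the connected components of $\mathcal{F}_{G_0}\setminus\mathcal{P}$, and the perimeter of a hole is the boundary between it and $\mathcal{P}$ in $G(\mathcal{P})$. Altan: if $H$ is a graph and $C$ is a cycle of $H$ containing $d\ge 2$ vertices of degree 2 in $H$, say $v_1,\dots,v_d$ in cyclic order along $C$, then $A(H,C)$ is obtained from $H$ by adding a new cycle $C'=w_1x_1w_2x_2\cdots w_dx_dw_1$ on $2d$ new vertices together with the $d$ edges $v_iw_i$, called spokes; $C'$ is the new perimeter. An admissible structure $(H;C_1,\dots,C_k)$ is a graph $H$ with cycles $C_1,\dots,C_k$ such that each $C_i$ contains at least two vertices of degree 2 in $H$ and each degree-2 vertex of $H$ lies on at most one $C_i$. The iterated generalised altan $A^{\mathbf{n}}(H;C_1,\dots,C_k)$ is obtained by performing, for each $i$, the altan operation $n_i$ times at position $i$, each time at the current cycle in position $i$ and then replacing that cycle by the newly created cycle (the order of the operations is irrelevant). A spoke of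 $G'$ is any edge added as a spoke in any of these operations. *)

theory Defs
  imports "HOL-Analysis.Analysis"
begin

section \<open>Simple graphs, cycles and Kekule structures\<close>

datatype 'a graph = Graph (verts: "'a set") (edges: "'a set set")

definition simple_graph :: "'a graph \<Rightarrow> bool" where
  "simple_graph G \<longleftrightarrow> (\<forall>e\<in>edges G. e \<subseteq> verts G \<and> card e = 2)"

definition degree :: "'a graph \<Rightarrow> 'a \<Rightarrow> nat" where
  "degree G v = card {e \<in> edges G. v \<in> e}"

definition cubic :: "'a graph \<Rightarrow> bool" where
  "cubic G \<longleftrightarrow> (\<forall>v\<in>verts G. degree G v = 3)"

definition kekule_structures :: "'a graph \<Rightarrow> 'a set set set" where
  "kekule_structures G = {M. M \<subseteq> edges G \<and> (\<forall>v\<in>verts G. \<exists>!e. e \<in> M \<and> v \<in> e)}"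

text \<open>A cycle is given by the list of its vertices in cyclic order, starting anywhere and
  running in either direction.\<close>

definition cycle_edges :: "'a list \<Rightarrow> 'a set set" where
  "cycle_edges C = {{C ! i, C ! (Suc i mod length C)} | i. i < length C}"

definition cycle_graph :: "'a list \<Rightarrow> 'a graph" where
  "cycle_graph C = Graph (set C) (cycle_edges C)"

definition is_cycle :: "'a graph \<Rightarrow> 'a list \<Rightarrow> bool" where
  "is_cycle G C \<longleftrightarrow>
     3 \<le> length C \<and> distinct C \<and> set C \<subseteq> verts G \<and> cycle_edges C \<subseteq> edges G"


section \<open>Plane graphs, perforated patches and their holes\<close>

text \<open>The vertices are points of the plane (the type \<^typ>\<open>complex\<close>), and \<open>\<gamma>\<close> assigns to every
  edge \<open>{u, v}\<close> a simple arc joining \<open>u\<close> and \<open>v\<close>. Distinct arcs meet only in vertices.\<close>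

definition plane_graph :: "complex graph \<Rightarrow> (complex set \<Rightarrow> real \<Rightarrow> complex) \<Rightarrow> bool" where
  "plane_graph G \<gamma> \<longleftrightarrow>
     finite (verts G) \<and> simple_graph G \<and>
     (\<forall>e\<in>edges G. arc (\<gamma> e) \<and> {pathstart (\<gamma> e), pathfinish (\<gamma> e)} = e \<and>
                    path_image (\<gamma> e) \<inter> verts G = e) \<and>
     (\<forall>e\<in>edges G. \<forall>e'\<in>edges G. e \<noteq> e' \<longrightarrow>
        path_image (\<gamma> e) \<inter> path_image (\<gamma> e') \<subseteq> verts G)"

definition faces :: "complex graph \<Rightarrow> (complex set \<Rightarrow> real \<Rightarrow> complex) \<Rightarrow> complex set set" where
  "faces G \<gamma> = components (- (verts G \<union> (\<Union>e\<in>edges G. path_image (\<gamma> e))))"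

definition boundary_edges ::
  "complex graph \<Rightarrow> (complex set \<Rightarrow> real \<Rightarrow> complex) \<Rightarrow> complex set \<Rightarrow> complex set set" where
  "boundary_edges G \<gamma> f = {e \<in> edges G. path_image (\<gamma> e) \<subseteq> frontier f}"

definition boundary_verts :: "complex graph \<Rightarrow> complex set \<Rightarrow> complex set" where
  "boundary_verts G f = verts G \<inter> frontier f"

definition adjacent_faces ::
  "complex graph \<Rightarrow> (complex set \<Rightarrow> real \<Rightarrow> complex) \<Rightarrow> complex set \<Rightarrow> complex set \<Rightarrow> bool" where
  "adjacent_faces G \<gamma> f g \<longleftrightarrow> f \<noteq> g \<and> boundary_edges G \<gamma> f \<inter> boundary_edges G \<gamma> g \<noteq> {}"

definition face_equiv ::
  "complex graph \<Rightarrow> (complex set \<Rightarrow> real \<Rightarrow> complex) \<Rightarrow> complex set set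
     \<Rightarrow> (complex set \<times> complex set) set" where
  "face_equiv G \<gamma> P =
     {(a, b) \<in> P \<times> P. (a, b) \<in> {(c, d). c \<in> P \<and> d \<in> P \<and> adjacent_faces G \<gamma> c d}\<^sup>*}"

definition connected_faces ::
  "complex graph \<Rightarrow> (complex set \<Rightarrow> real \<Rightarrow> complex) \<Rightarrow> complex set set \<Rightarrow> bool" where
  "connected_faces G \<gamma> P \<longleftrightarrow> P \<noteq> {} \<and> (\<forall>a\<in>P. \<forall>b\<in>P. (a, b) \<in> face_equiv G \<gamma> P)"

definition perforated_patch ::
  "complex graph \<Rightarrow> (complex set \<Rightarrow> real \<Rightarrow> complex) \<Rightarrow> complex set set \<Rightarrow> bool" where
  "perforated_patch G \<gamma> P \<longleftrightarrow> P \<subset> faces G \<gamma> \<and> connected_faces G \<gamma> P"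

definition skeleton ::
  "complex graph \<Rightarrow> (complex set \<Rightarrow> real \<Rightarrow> complex) \<Rightarrow> complex set set \<Rightarrow> complex graph" where
  "skeleton G \<gamma> P = Graph (\<Union>f\<in>P. boundary_verts G f) (\<Union>f\<in>P. boundary_edges G \<gamma> f)"

definition holes ::
  "complex graph \<Rightarrow> (complex set \<Rightarrow> real \<Rightarrow> complex) \<Rightarrow> complex set set \<Rightarrow> complex set set set" where
  "holes G \<gamma> P = (faces G \<gamma> - P) // face_equiv G \<gamma> (faces G \<gamma> - P)"

text \<open>The perimeter of a hole \<open>h\<close> is the subgraph formed by the edges that separate a face of
  \<open>h\<close> from a face of \<open>P\<close>, together with the end-vertices of these edges.\<close>

definition perimeter ::
  "complex graph \<Rightarrow> (complex set \<Rightarrow> real \<Rightarrow> complex) \<Rightarrow> complex set set \<Rightarrow> complex set set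
     \<Rightarrow> complex graph" where
  "perimeter G \<gamma> P h =
     (let B = (\<Union>f\<in>h. boundary_edges G \<gamma> f) \<inter> (\<Union>f\<in>P. boundary_edges G \<gamma> f)
      in Graph (\<Union>B) B)"


section \<open>Altans\<close>

definition admissible :: "'a graph \<Rightarrow> 'a list list \<Rightarrow> bool" where
  "admissible H Cs \<longleftrightarrow>
     (\<forall>C\<in>set Cs. is_cycle H C \<and> 2 \<le> card {v \<in> set C. degree H v = 2}) \<and>
     (\<forall>v\<in>verts H. degree H v = 2 \<longrightarrow>
        (\<forall>i<length Cs. \<forall>j<length Cs. v \<in> set (Cs ! i) \<and> v \<in> set (Cs ! j) \<longrightarrow> i = j))"

text \<open>\<open>is_altan H C H' C' S\<close>: the graph \<open>H'\<close> is the altan \<open>A(H, C)\<close>, built on some choice of new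
  vertices \<open>ws\<close> and \<open>xs\<close>, with new perimeter \<open>C'\<close> and set of spokes \<open>S\<close>. The altan is
  determined only up to the names of the new vertices, hence a relation. That \<open>C\<close> is a cycle of
  \<open>H\<close> with at least two vertices of degree 2 is not repeated here; when starting from an
  admissible structure this holds at every step.\<close>

definition is_altan ::
  "'a graph \<Rightarrow> 'a list \<Rightarrow> 'a graph \<Rightarrow> 'a list \<Rightarrow> 'a set set \<Rightarrow> bool" where
  "is_altan H C H' C' S \<longleftrightarrow>
     (\<exists>ws xs. let vs = filter (\<lambda>v. degree H v = 2) C in
        length ws = length vs \<and> length xs = length vs \<and>
        distinct (ws @ xs) \<and> set (ws @ xs) \<inter> verts H = {} \<and>
        C' = concat (map2 (\<lambda>w x. [w, x]) ws xs) \<and>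
        S = {{vs ! i, ws ! i} | i. i < length vs} \<and>
        H' = Graph (verts H \<union> set ws \<union> set xs) (edges H \<union> cycle_edges C' \<union> S))"

text \<open>\<open>iterated_altan H Cs ns H' Cs' S\<close>: starting from \<open>(H; Cs)\<close>, performing \<open>ns ! i\<close> altan
  operations at each position \<open>i\<close>, in some order, yields the graph \<open>H'\<close> with current cycles
  \<open>Cs'\<close>; \<open>S\<close> collects the spokes of all these operations.\<close>

inductive iterated_altan ::
  "'a graph \<Rightarrow> 'a list list \<Rightarrow> nat list \<Rightarrow> 'a graph \<Rightarrow> 'a list list \<Rightarrow> 'a set set \<Rightarrow> bool"
  for H :: "'a graph" and Cs :: "'a list list" where
  start: "iterated_altan H Cs (replicate (length Cs) 0) H Cs {}"
| step: "iterated_altan H Cs (ns[i := Suc (ns ! i)]) H'' (Cs'[i := C]) (S \<union> T)"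
    if "iterated_altan H Cs ns H' Cs' S" and "i < length Cs" and "is_altan H' (Cs' ! i) H'' C T"

text \<open>On an infinite type new vertices are always available, so iterated altans exist.\<close>

lemma is_altan_exists:
  fixes H :: "'a graph"
  assumes inf: "infinite (UNIV :: 'a set)" and fin: "finite (verts H)"
  shows "\<exists>H' C' S. is_altan H C H' C' S \<and> finite (verts H')"
proof -
  let ?vs = "filter (\<lambda>v. degree H v = 2) C"
  let ?d = "length ?vs"
  have "infinite (UNIV - verts H)" using inf fin by simp
  then obtain N where N: "finite N" "card N = ?d + ?d" "N \<subseteq> UNIV - verts H"
    using infinite_arbitrarily_large by blast
  from finite_distinct_list[OF N(1)] obtain zs where zs: "set zs = N" "distinct zs" by blast
  then have len: "length zs = ?d + ?d" using N(2) distinct_card by fastforce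
  let ?C' = "concat (map2 (\<lambda>w x. [w, x]) (take ?d zs) (drop ?d zs))"
  let ?S = "{{?vs ! i, take ?d zs ! i} | i. i < ?d}"
  let ?H' = "Graph (verts H \<union> set (take ?d zs) \<union> set (drop ?d zs)) (edges H \<union> cycle_edges ?C' \<union> ?S)"
  have "is_altan H C ?H' ?C' ?S"
    unfolding is_altan_def Let_def
    by (rule exI[of _ "take ?d zs"], rule exI[of _ "drop ?d zs"]) (use len zs N(3) in auto)
  then show ?thesis using fin by fastforce
qed

lemma iterated_altan_exists:
  fixes H :: "'a graph"
  assumes inf: "infinite (UNIV :: 'a set)" and fin: "finite (verts H)"
    and len: "length ns = length Cs"
  shows "\<exists>H' Cs' S. iterated_altan H Cs ns H' Cs' S \<and> finite (verts H')"
  using len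
proof (induction "sum_list ns" arbitrary: ns)
  case 0
  then have "ns = replicate (length Cs) 0" by (metis replicate_eqI sum_list_eq_0_iff)
  then show ?case using fin iterated_altan.start by blast
next
  case (Suc s)
  then obtain i where i: "i < length ns" "ns ! i > 0"
    by (metis in_set_conv_nth neq0_conv sum_list_eq_0_iff Zero_not_Suc)
  let ?ms = "ns[i := ns ! i - 1]"
  have "s = sum_list ?ms" using i Suc.hyps(2) by (simp add: sum_list_update elem_le_sum_list)
  from Suc.hyps(1)[OF this] Suc.prems obtain H' Cs' S
    where *: "iterated_altan H Cs ?ms H' Cs' S" "finite (verts H')" by auto
  from is_altan_exists[OF inf *(2)] obtain H'' C T
    where "is_altan H' (Cs' ! i) H'' C T" "finite (verts H'')" by blast
  with iterated_altan.step[OF *(1), of i] i Suc.prems show ?case by fastforce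
qed

end

theory Submission
  imports Defs
begin

text \<open>The vertices \<open>x\<^sub>i\<close> of a newly added cycle have degree 2, and both neighbours of each of them
  are among the \<open>w\<^sub>j\<close>. As there are equally many of both kinds, a Kekule structure matches the
  \<open>x\<^sub>i\<close> with the \<open>w\<^sub>j\<close>, in one of the two ways available on an even cycle, and leaves out all
  spokes. So every altan operation doubles the set of Kekule structures. Admissibility is
  essentially inherited by the altan, so each new cycle has at least four vertices and the two
  ways differ.\<close>

section \<open>Interleaved lists and the cycles they describe\<close>

lemma length_interleave:
  "length ws = length xs \<Longrightarrow> length (concat (map2 (\<lambda>w x. [w, x]) ws xs)) = 2 * length ws"
  by (induction ws xs rule: list_induct2) auto

lemma set_interleave:
  "length ws = length xs \<Longrightarrow> set (concat (map2 (\<lambda>w x. [w, x]) ws xs)) = set ws \<union> set xs"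
  by (induction ws xs rule: list_induct2) auto

lemma nth_interleave:
  assumes "length ws = length xs" and "i < length ws"
  shows "concat (map2 (\<lambda>w x. [w, x]) ws xs) ! (2 * i) = ws ! i"
    and "concat (map2 (\<lambda>w x. [w, x]) ws xs) ! Suc (2 * i) = xs ! i"
  using assms
proof (induction ws xs arbitrary: i rule: list_induct2)
  case (Cons w ws x xs)
  { case 1 with Cons.IH show ?case by (cases i) auto }
  { case 2 with Cons.IH show ?case by (cases i) auto }
qed auto

text \<open>Sorting the positions of the cycle by parity splits its edges into two classes of
  alternating edges, which later become its two perfect matchings.\<close>

lemma cycle_edges_interleave:
  assumes "length ws = length xs"
  defines "d \<equiv> length ws"
  shows "cycle_edges (concat (map2 (\<lambda>w x. [w, x]) ws xs)) =
    (\<lambda>i. {ws ! i, xs ! i}) ` {..<d} \<union> (\<lambda>i. {xs ! i, ws ! (Suc i mod d)}) ` {..<d}"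
proof -
  let ?C = "concat (map2 (\<lambda>w x. [w, x]) ws xs)"
  let ?e = "\<lambda>k. {?C ! k, ?C ! (Suc k mod (2 * d))}"
  have even: "?e (2 * i) = {ws ! i, xs ! i}" if "i < d" for i
    using that nth_interleave[OF assms(1)] by (simp add: d_def)
  have odd: "?e (Suc (2 * i)) = {xs ! i, ws ! (Suc i mod d)}" if "i < d" for i
  proof -
    \<comment> \<open>The position after an odd one is even, and going round the long cycle modulo
      \<open>2 * d\<close> amounts to going round the \<open>ws\<close> modulo
      \<open>d\<close>.\<close>
    have "Suc (Suc (2 * i)) mod (2 * d) = 2 * (Suc i mod d)"
      by (metis mult_Suc_right add_2_eq_Suc mult_mod_right)
    moreover have "Suc i mod d < d" using that by simp
    ultimately show ?thesis
      using that nth_interleave[OF assms(1)] by (simp add: d_def del: mod_Suc_eq)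
  qed
  have "{..<2 * d} = (\<lambda>i. 2 * i) ` {..<d} \<union> (\<lambda>i. Suc (2 * i)) ` {..<d}"
  proof (intro equalityI subsetI)
    fix k assume "k \<in> {..<2 * d}"
    then have "k = 2 * (k div 2) \<or> k = Suc (2 * (k div 2))" "k div 2 < d" by auto
    then show "k \<in> (\<lambda>i. 2 * i) ` {..<d} \<union> (\<lambda>i. Suc (2 * i)) ` {..<d}" by blast
  qed auto
  moreover have "cycle_edges ?C = ?e ` {..<2 * d}"
    unfolding cycle_edges_def by (auto simp: length_interleave[OF assms(1)] d_def)
  ultimately have "cycle_edges ?C =
      (\<lambda>i. ?e (2 * i)) ` {..<d} \<union> (\<lambda>i. ?e (Suc (2 * i))) ` {..<d}"
    by (simp add: image_Un image_image)
  then show ?thesis using even odd by simp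
qed

section \<open>A single altan operation: incidences and degrees\<close>

text \<open>\<open>vs\<close> stands for the degree-2 vertices along the cycle where the altan is
  formed. The bound on its length gives the new cycle at least four vertices.\<close>

locale altan =
  fixes H :: "'a graph" and vs ws xs :: "'a list"
  assumes simple: "simple_graph H"
    and len_ws: "length ws = length vs" and len_xs: "length xs = length vs"
    and two: "2 \<le> length vs"
    and vs_verts: "set vs \<subseteq> verts H"
    and dist: "distinct (ws @ xs)"
    and fresh: "set (ws @ xs) \<inter> verts H = {}"
begin

abbreviation d :: nat where "d \<equiv> length vs"

abbreviation C' :: "'a list" where "C' \<equiv> concat (map2 (\<lambda>w x. [w, x]) ws xs)"

abbreviation spokes :: "'a set set" where "spokes \<equiv> {{vs ! i, ws ! i} | i. i < length vs}"

abbreviation H' :: "'a graph" where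
  "H' \<equiv> Graph (verts H \<union> set ws \<union> set xs) (edges H \<union> cycle_edges C' \<union> spokes)"

text \<open>\<open>a i\<close> and \<open>b i\<close> are the edges of the new cycle leading from
  \<open>xs ! i\<close> to its predecessor and to its successor.\<close>

definition a :: "nat \<Rightarrow> 'a set" where "a i = {ws ! i, xs ! i}"
definition b :: "nat \<Rightarrow> 'a set" where "b i = {xs ! i, ws ! (Suc i mod d)}"
text \<open>\<open>A\<close> and \<open>B\<close> are the two perfect matchings of the even cycle
  \<open>C'\<close>.\<close>

definition A :: "'a set set" where "A = a ` {..<d}"
definition B :: "'a set set" where "B = b ` {..<d}"

lemma cycle_edges_C': "cycle_edges C' = A \<union> B"
  using cycle_edges_interleave[of ws xs] len_ws len_xs by (simp add: A_def B_def a_def b_def)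

lemma Suc_mod_less: "Suc i mod d < d"
  using two by (intro mod_less_divisor) linarith

text \<open>The bound \<open>2 \<le> d\<close> matters here: for \<open>d = 1\<close> the edges
  \<open>a 0\<close> and \<open>b 0\<close> would coincide.\<close>

lemma Suc_mod_neq: "i < d \<Longrightarrow> Suc i mod d \<noteq> i"
  using two by (cases "Suc i = d") auto

lemma Suc_mod_inj: "i < d \<Longrightarrow> j < d \<Longrightarrow> Suc i mod d = Suc j mod d \<longleftrightarrow> i = j"
  by (auto simp: mod_Suc split: if_splits)

lemma Suc_mod_surj: "i < d \<Longrightarrow> \<exists>j<d. Suc j mod d = i"
  using two by (cases i) (auto intro: exI[of _ "d - 1"] exI[of _ "i - 1"])

lemma ws_eq: "i < d \<Longrightarrow> j < d \<Longrightarrow> ws ! i = ws ! j \<longleftrightarrow> i = j"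
  using dist len_ws by (simp add: nth_eq_iff_index_eq)

lemma xs_eq: "i < d \<Longrightarrow> j < d \<Longrightarrow> xs ! i = xs ! j \<longleftrightarrow> i = j"
  using dist len_xs by (simp add: nth_eq_iff_index_eq)

lemma ws_neq_xs: "i < d \<Longrightarrow> j < d \<Longrightarrow> ws ! i \<noteq> xs ! j" "i < d \<Longrightarrow> j < d \<Longrightarrow> xs ! j \<noteq> ws ! i"
  using dist len_ws len_xs by (auto simp: disjoint_iff) (metis nth_mem)+

lemma ws_fresh: "i < d \<Longrightarrow> ws ! i \<notin> verts H"
  using fresh len_ws nth_mem[of i ws] by (auto simp: disjoint_iff)

lemma xs_fresh: "i < d \<Longrightarrow> xs ! i \<notin> verts H"
  using fresh len_xs nth_mem[of i xs] by (auto simp: disjoint_iff)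

lemma vs_in: "i < d \<Longrightarrow> vs ! i \<in> verts H"
  using vs_verts nth_mem by blast

lemma edge_subset: "e \<in> edges H \<Longrightarrow> e \<subseteq> verts H"
  using simple by (auto simp: simple_graph_def)

lemma edge_nonempty: "e \<in> edges H \<Longrightarrow> e \<noteq> {}"
  using simple by (force simp: simple_graph_def)

lemma x_in_a: "i < d \<Longrightarrow> j < d \<Longrightarrow> xs ! i \<in> a j \<longleftrightarrow> i = j"
  by (auto simp: a_def xs_eq ws_neq_xs)

lemma x_in_b: "i < d \<Longrightarrow> j < d \<Longrightarrow> xs ! i \<in> b j \<longleftrightarrow> i = j"
  by (auto simp: b_def xs_eq ws_neq_xs Suc_mod_less)

lemma w_in_a: "i < d \<Longrightarrow> j < d \<Longrightarrow> ws ! i \<in> a j \<longleftrightarrow> i = j"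
  by (auto simp: a_def ws_eq ws_neq_xs)

lemma w_in_b: "i < d \<Longrightarrow> j < d \<Longrightarrow> ws ! i \<in> b j \<longleftrightarrow> i = Suc j mod d"
  by (auto simp: b_def ws_eq ws_neq_xs Suc_mod_less)

text \<open>A common edge would contain \<open>xs ! i\<close>, forcing \<open>i = j\<close>, and
  also \<open>ws ! i\<close>, which \<open>b i\<close> misses because the cyclic successor of
  \<open>i\<close> is not \<open>i\<close>.\<close>

lemma a_neq_b: "i < d \<Longrightarrow> j < d \<Longrightarrow> a i \<noteq> b j"
  using x_in_a[of i i] x_in_b[of i j] w_in_a[of i i] w_in_b[of i j] Suc_mod_neq[of i] by auto

lemma A_B_disjoint: "A \<inter> B = {}"
  using a_neq_b by (auto simp: A_def B_def)

lemma cycle_edge_disjoint: "e \<in> A \<union> B \<Longrightarrow> e \<inter> verts H = {}"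
  using ws_fresh xs_fresh Suc_mod_less by (auto simp: A_def B_def a_def b_def)

lemma cycle_edges_new: "(A \<union> B) \<inter> edges H = {}"
  using cycle_edge_disjoint edge_subset edge_nonempty by blast

text \<open>A spoke has one old and one new end, whereas edges of \<open>H\<close> have only old
  ends and edges of the new cycle only new ones.\<close>

lemma spoke_new: "s \<in> spokes \<Longrightarrow> s \<notin> edges H" "s \<in> spokes \<Longrightarrow> s \<notin> A \<union> B"
proof -
  assume "s \<in> spokes"
  then obtain i where i: "i < d" "s = {vs ! i, ws ! i}" by auto
  show "s \<notin> edges H" using i ws_fresh edge_subset by blast
  show "s \<notin> A \<union> B" using i vs_in cycle_edge_disjoint by blast
qed

text \<open>Spokes end at the \<open>ws\<close>, never at the \<open>xs\<close>. So each
  \<open>xs ! i\<close> has degree 2 and can be matched only along the new cycle.\<close>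

lemma x_edges: "i < d \<Longrightarrow> {e \<in> edges H'. xs ! i \<in> e} = {a i, b i}"
proof -
  assume i: "i < d"
  have "xs ! i \<notin> e" if "e \<in> edges H" for e using that edge_subset xs_fresh[OF i] by blast
  moreover have "xs ! i \<notin> e" if "e \<in> spokes" for e
    using that i xs_fresh vs_in ws_neq_xs by fastforce
  ultimately show ?thesis
    using i by (auto simp: cycle_edges_C' A_def B_def x_in_a x_in_b)
qed

lemma degree_x: "i < d \<Longrightarrow> degree H' (xs ! i) = 2"
  using x_edges[of i] a_neq_b[of i i] by (simp add: degree_def)

text \<open>Among the old vertices, only the ends of spokes gain an edge. This keeps the degree-2
  vertices of the other cycles available.\<close>

lemma degree_old:
  assumes "v \<in> verts H" "v \<notin> set vs"
  shows "degree H' v = degree H v"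
proof -
  have "v \<notin> e" if "e \<in> A \<union> B" for e using that assms cycle_edge_disjoint by blast
  moreover have "v \<notin> e" if "e \<in> spokes" for e using that assms ws_fresh by force
  ultimately have "{e \<in> edges H'. v \<in> e} = {e \<in> edges H. v \<in> e}"
    by (auto simp: cycle_edges_C')
  then show ?thesis by (simp add: degree_def)
qed

lemma simple_H': "simple_graph H'"
  unfolding simple_graph_def
proof
  fix e assume "e \<in> edges H'"
  then consider "e \<in> edges H" | i where "i < d" "e = a i" | i where "i < d" "e = b i"
    | i where "i < d" "e = {vs ! i, ws ! i}"
    by (auto simp: cycle_edges_C' A_def B_def)
  then show "e \<subseteq> verts H' \<and> card e = 2"
  proof cases
    case 1 then show ?thesis using simple by (auto simp: simple_graph_def)
  next
    case 2 then show ?thesis using ws_neq_xs len_ws len_xs by (simp add: a_def)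
  next
    case 3 then show ?thesis using ws_neq_xs Suc_mod_less[of i] len_ws len_xs by (simp add: b_def)
  next
    case 4
    then have "vs ! i \<noteq> ws ! i" using vs_in ws_fresh by metis
    then show ?thesis using 4 vs_in len_ws by simp
  qed
qed

section \<open>Kekule structures of a single altan\<close>

text \<open>\<open>M\<close> covers exactly the old vertices and \<open>N\<close> exactly the new
  ones, so neither disturbs the uniqueness of the other.\<close>

lemma kekule_extend:
  assumes M: "M \<in> kekule_structures H" and N: "N \<in> {A, B}"
  shows "M \<union> N \<in> kekule_structures H'"
proof -
  have NAB: "N \<subseteq> A \<union> B" using N by auto
  have MH: "M \<subseteq> edges H" using M by (simp add: kekule_structures_def)
  have old: "\<exists>!e. e \<in> M \<union> N \<and> v \<in> e" if v: "v \<in> verts H" for v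
  proof -
    have "\<exists>!e. e \<in> M \<and> v \<in> e" using M v by (simp add: kekule_structures_def)
    moreover have "v \<notin> e" if "e \<in> N" for e using that v NAB cycle_edge_disjoint by blast
    ultimately show ?thesis by blast
  qed
  have new: "\<exists>!e. e \<in> M \<union> N \<and> v \<in> e" if "\<exists>!e. e \<in> N \<and> v \<in> e" "v \<notin> verts H" for v
  proof -
    have "v \<notin> e" if "e \<in> M" for e using that \<open>v \<notin> verts H\<close> MH edge_subset by blast
    then show ?thesis using that(1) by blast
  qed
  have w: "\<exists>!e. e \<in> N \<and> ws ! i \<in> e" if i: "i < d" for i
  proof (cases "N = A")
    case True
    then show ?thesis using i by (intro ex1I[of _ "a i"]) (auto simp: A_def w_in_a)
  next
    case False
    \<comment> \<open>In \<open>B\<close>, the vertex \<open>ws ! i\<close> is matched with the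
      \<open>xs\<close> vertex preceding it, so the index needed is the cyclic predecessor of
      \<open>i\<close>.\<close>
    obtain j where "j < d" "Suc j mod d = i" using Suc_mod_surj i by blast
    then show ?thesis using i False N Suc_mod_inj
      by (intro ex1I[of _ "b j"]) (auto simp: B_def w_in_b)
  qed
  have x: "\<exists>!e. e \<in> N \<and> xs ! i \<in> e" if i: "i < d" for i
  proof (cases "N = A")
    case True
    then show ?thesis using i by (intro ex1I[of _ "a i"]) (auto simp: A_def x_in_a)
  next
    case False
    then show ?thesis using i N by (intro ex1I[of _ "b i"]) (auto simp: B_def x_in_b)
  qed
  have "\<exists>!e. e \<in> M \<union> N \<and> v \<in> e" if v: "v \<in> verts H'" for v
  proof -
    consider "v \<in> verts H" | i where "i < d" "v = ws ! i" | i where "i < d" "v = xs ! i"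
      using v len_ws len_xs by (auto simp: in_set_conv_nth)
    then show ?thesis
    proof cases
      case 1 then show ?thesis by (rule old)
    next
      case 2 then show ?thesis using new[OF w ws_fresh] by simp
    next
      case 3 then show ?thesis using new[OF x xs_fresh] by simp
    qed
  qed
  then show ?thesis
    using MH NAB unfolding kekule_structures_def by (simp add: cycle_edges_C') blast
qed

text \<open>Each \<open>xs ! i\<close> uses \<open>a i\<close> or \<open>b i\<close>. Once some
  \<open>b i\<close> is used, the next \<open>ws\<close> vertex is taken, which excludes the next
  \<open>a\<close> and forces the next \<open>b\<close>; this propagates round the whole
  cycle.\<close>

lemma kekule_cycle_edges:
  assumes M: "M \<in> kekule_structures H'"
  shows "A \<subseteq> M \<or> B \<subseteq> M"
proof (rule disjCI)
  have uniq: "e = f" if "e \<in> M" "f \<in> M" "v \<in> e" "v \<in> f" "v \<in> verts H'" for e f v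
    using M that unfolding kekule_structures_def by blast
  have a_or_b: "a i \<in> M \<or> b i \<in> M" if i: "i < d" for i
  proof -
    have "xs ! i \<in> verts H'" using i len_xs by simp
    then obtain e where "e \<in> M" "xs ! i \<in> e" using M unfolding kekule_structures_def by blast
    moreover have "M \<subseteq> edges H'" using M by (simp add: kekule_structures_def)
    ultimately have "e \<in> {a i, b i}" using x_edges[OF i] by blast
    then show ?thesis using \<open>e \<in> M\<close> by blast
  qed
  have next_b: "b (Suc i mod d) \<in> M" if i: "i < d" "b i \<in> M" for i
  proof -
    let ?j = "Suc i mod d"
    have "ws ! ?j \<in> a ?j" "ws ! ?j \<in> b i" by (simp_all add: a_def b_def)
    moreover have "ws ! ?j \<in> verts H'" using Suc_mod_less len_ws by simp
    ultimately have "a ?j \<notin> M" 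
      using uniq[of "a ?j" "b i" "ws ! ?j"] i a_neq_b[OF Suc_mod_less i(1)] by blast
    then show ?thesis using a_or_b[OF Suc_mod_less] by blast
  qed
  assume "\<not> B \<subseteq> M"
  then obtain k where k: "k < d" "b k \<notin> M" by (auto simp: B_def)
  show "A \<subseteq> M"
  proof (rule ccontr)
    assume "\<not> A \<subseteq> M"
    then obtain i where i: "i < d" "b i \<in> M" using a_or_b by (auto simp: A_def)
    have "b ((i + n) mod d) \<in> M" for n
    proof (induction n)
      case 0 show ?case using i by simp
    next
      case (Suc n)
      have "(i + n) mod d < d" using two by (intro mod_less_divisor) linarith
      then show ?case using next_b[OF _ Suc] by (simp add: mod_simps)
    qed
    \<comment> \<open>Since \<open>i < d\<close>, advancing by \<open>d - i + k\<close> from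
      \<open>i\<close> reaches \<open>d + k\<close>, which is \<open>k\<close> modulo
      \<open>d\<close>; but \<open>b k\<close> is absent.\<close>
    from this[of "d - i + k"] show False using i k by simp
  qed
qed

text \<open>The matching \<open>N\<close> found on the new cycle covers all \<open>ws\<close>.
  Spokes and the remaining cycle edges each contain one of the \<open>ws\<close>, so the rest of
  \<open>M\<close> lies in \<open>H\<close>.\<close>

lemma kekule_cases:
  assumes M: "M \<in> kekule_structures H'"
  shows "\<exists>M\<^sub>0\<in>kekule_structures H. \<exists>N\<in>{A, B}. M = M\<^sub>0 \<union> N"
proof -
  obtain N where N: "N \<in> {A, B}" "N \<subseteq> M" using kekule_cycle_edges[OF M] by blast
  have uniq: "e = f" if "e \<in> M" "f \<in> M" "v \<in> e" "v \<in> f" "v \<in> verts H'" for e f v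
    using M that unfolding kekule_structures_def by blast
  have ME: "M \<subseteq> edges H \<union> (A \<union> B) \<union> spokes"
    using M by (auto simp: kekule_structures_def cycle_edges_C')
  have cover: "\<exists>f\<in>N. ws ! i \<in> f" if i: "i < d" for i
    using N(1) i w_in_a w_in_b Suc_mod_surj[OF i] unfolding A_def B_def by blast
  have no_other: "e \<in> N" if "e \<in> M" "ws ! i \<in> e" "i < d" for e i
    using cover[OF that(3)] uniq[OF that(1) _ that(2)] N(2) that(3) len_ws by auto
  have "e \<notin> spokes" if "e \<in> M" for e
    using no_other[OF that] spoke_new(2) N(1) by blast
  moreover have "e \<in> N" if "e \<in> M" "e \<in> A \<union> B" for e
    using no_other[OF that(1)] that(2) Suc_mod_less by (auto simp: A_def B_def a_def b_def)
  ultimately have "M \<subseteq> edges H \<union> N" using ME by auto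
  then have eq: "M = (M \<inter> edges H) \<union> N" using N(2) by auto
  \<comment> \<open>No edge of \<open>N\<close> meets an old vertex, so dropping \<open>N\<close>
    leaves the covering of \<open>H\<close> intact.\<close>
  have "\<exists>!e. e \<in> M \<inter> edges H \<and> v \<in> e" if v: "v \<in> verts H" for v
  proof -
    have "\<exists>!e. e \<in> M \<and> v \<in> e" using M v by (simp add: kekule_structures_def)
    moreover have "v \<notin> e" if "e \<in> N" for e using that v N(1) cycle_edge_disjoint by blast
    ultimately show ?thesis using \<open>M \<subseteq> edges H \<union> N\<close> by blast
  qed
  then have "M \<inter> edges H \<in> kekule_structures H" by (simp add: kekule_structures_def)
  then show ?thesis using eq N(1) by blast
qed

lemma kekule_altan:
  "kekule_structures H' = (\<lambda>(M, N). M \<union> N) ` (kekule_structures H \<times> {A, B})"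
proof
  show "kekule_structures H' \<subseteq> (\<lambda>(M, N). M \<union> N) ` (kekule_structures H \<times> {A, B})"
    using kekule_cases by fast
  show "(\<lambda>(M, N). M \<union> N) ` (kekule_structures H \<times> {A, B}) \<subseteq> kekule_structures H'"
    using kekule_extend by fast
qed

section \<open>Counting Kekule structures of a single altan\<close>

lemma A_neq_B: "A \<noteq> B"
proof -
  have "a 0 \<in> A" using two by (auto simp: A_def)
  then show ?thesis using A_B_disjoint by auto
qed

lemma kekule_subset: "M \<in> kekule_structures H \<Longrightarrow> M \<subseteq> edges H"
  by (simp add: kekule_structures_def)

lemma inj_kekule: "inj_on (\<lambda>(M, N). M \<union> N) (kekule_structures H \<times> {A, B})"
proof (rule inj_on_inverseI)
  fix p assume "p \<in> kekule_structures H \<times> {A, B}"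
  then obtain M N where "p = (M, N)" "M \<subseteq> edges H" "N \<in> {A, B}" using kekule_subset by auto
  \<comment> \<open>The two components are recovered by intersecting with the disjoint sets of old
    edges and new cycle edges.\<close>
  then show "(\<lambda>X. (X \<inter> edges H, X \<inter> (A \<union> B))) (case p of (M, N) \<Rightarrow> M \<union> N) = p"
    using cycle_edges_new by auto
qed

lemma card_kekule_image:
  "X \<subseteq> kekule_structures H \<times> {A, B} \<Longrightarrow> card ((\<lambda>(M, N). M \<union> N) ` X) = card X"
  by (rule card_image) (rule inj_on_subset[OF inj_kekule])

lemma card_kekule: "card (kekule_structures H') = 2 * card (kekule_structures H)"
  unfolding kekule_altan using A_neq_B
  by (subst card_kekule_image) (auto simp: card_cartesian_product)

text \<open>Both extensions of a structure agree on old edges. Together with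
  \<open>card_kekule\<close> this preserves the proportion of structures containing an old
  edge.\<close>

lemma card_kekule_old_edge:
  assumes "e \<in> edges H"
  shows "card {M \<in> kekule_structures H'. e \<in> M} = 2 * card {M \<in> kekule_structures H. e \<in> M}"
proof -
  have "e \<notin> A" "e \<notin> B" using assms cycle_edges_new by blast+
  then have "{M \<in> kekule_structures H'. e \<in> M} =
      (\<lambda>(M, N). M \<union> N) ` ({M \<in> kekule_structures H. e \<in> M} \<times> {A, B})"
    unfolding kekule_altan by auto
  moreover have "{M \<in> kekule_structures H. e \<in> M} \<times> {A, B} \<subseteq> kekule_structures H \<times> {A, B}"
    by blast
  ultimately show ?thesis using A_neq_B
    by (simp add: card_kekule_image card_cartesian_product)
qed

text \<open>The edge lies in exactly one of \<open>A\<close> and \<open>B\<close>, hence in exactly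
  one of the two extensions of each structure of \<open>H\<close>.\<close>

lemma card_kekule_new_edge:
  assumes "e \<in> cycle_edges C'"
  shows "card {M \<in> kekule_structures H'. e \<in> M} = card (kekule_structures H)"
proof -
  obtain N where N: "N \<in> {A, B}" "\<And>L. L \<in> {A, B} \<Longrightarrow> e \<in> L \<longleftrightarrow> L = N"
    using assms A_B_disjoint unfolding cycle_edges_C' by blast
  have "e \<notin> M" if "M \<in> kekule_structures H" for M
    using that assms kekule_subset cycle_edges_new unfolding cycle_edges_C' by blast
  then have "{M \<in> kekule_structures H'. e \<in> M} =
      (\<lambda>(M, N). M \<union> N) ` (kekule_structures H \<times> {N})"
    unfolding kekule_altan using N by auto
  moreover have "kekule_structures H \<times> {N} \<subseteq> kekule_structures H \<times> {A, B}" using N(1) by blast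
  ultimately show ?thesis by (simp add: card_kekule_image card_cartesian_product)
qed

lemma new_spoke_unused: "M \<in> kekule_structures H' \<Longrightarrow> s \<in> spokes \<Longrightarrow> s \<notin> M"
proof
  assume M: "M \<in> kekule_structures H'" and s: "s \<in> spokes" and "s \<in> M"
  then obtain M\<^sub>0 N where "M\<^sub>0 \<in> kekule_structures H" "N \<in> {A, B}" "s \<in> M\<^sub>0 \<union> N"
    using kekule_cases[OF M] by blast
  then show False using spoke_new[OF s] kekule_subset by blast
qed

text \<open>Meant for spokes of earlier operations, which are ordinary edges of \<open>H\<close> by
  now: the part added to a structure contains no old edge.\<close>

lemma old_edge_unused:
  assumes "s \<in> edges H" "\<forall>M\<in>kekule_structures H. s \<notin> M" "M \<in> kekule_structures H'"
  shows "s \<notin> M"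
  using kekule_cases[OF assms(3)] assms(1,2) cycle_edges_new by blast

end

section \<open>The invariant of the iteration\<close>

text \<open>What an altan operation needs and hands on to the next one: a form of admissibility
  together with simplicity and finiteness of the graph.\<close>

definition altan_ready :: "'a graph \<Rightarrow> 'a list list \<Rightarrow> bool" where
  "altan_ready H Cs \<longleftrightarrow> simple_graph H \<and> finite (verts H) \<and>
     (\<forall>C\<in>set Cs. set C \<subseteq> verts H \<and> cycle_edges C \<subseteq> edges H \<and>
        2 \<le> card {v \<in> set C. degree H v = 2}) \<and>
     (\<forall>i<length Cs. \<forall>j<length Cs. \<forall>v. degree H v = 2 \<longrightarrow>
        v \<in> set (Cs ! i) \<longrightarrow> v \<in> set (Cs ! j) \<longrightarrow> i = j)"

lemma admissible_imp_altan_ready: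
  assumes "simple_graph H" "finite (verts H)" "admissible H Cs"
  shows "altan_ready H Cs"
proof -
  have cyc: "set C \<subseteq> verts H" "cycle_edges C \<subseteq> edges H" "2 \<le> card {v \<in> set C. degree H v = 2}"
    if "C \<in> set Cs" for C
    using assms(3) that by (auto simp: admissible_def is_cycle_def)
  have "i = j" if "i < length Cs" "j < length Cs" "degree H v = 2"
      "v \<in> set (Cs ! i)" "v \<in> set (Cs ! j)" for i j v
  proof -
    have "v \<in> verts H" using cyc(1)[OF nth_mem[OF that(1)]] that(4) by blast
    then show ?thesis using assms(3) that unfolding admissible_def by blast
  qed
  moreover have "\<forall>C\<in>set Cs. set C \<subseteq> verts H \<and> cycle_edges C \<subseteq> edges H \<and>
      2 \<le> card {v \<in> set C. degree H v = 2}"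
    using cyc by simp
  ultimately show ?thesis using assms(1,2) unfolding altan_ready_def by presburger
qed

lemma is_altan_imp_altan:
  assumes "altan_ready H Cs" "i < length Cs" "is_altan H (Cs ! i) H' C' S"
  defines "vs \<equiv> filter (\<lambda>v. degree H v = 2) (Cs ! i)"
  obtains ws xs where "altan H vs ws xs" "C' = altan.C' ws xs" "S = altan.spokes vs ws"
    "H' = altan.H' H vs ws xs"
proof -
  have C: "set (Cs ! i) \<subseteq> verts H" "2 \<le> card {v \<in> set (Cs ! i). degree H v = 2}"
    using assms(1,2) by (auto simp: altan_ready_def)
  \<comment> \<open>A list has at least as many entries as distinct members, so the bound for the
    set of degree-2 vertices passes to the list \<open>vs\<close>.\<close>
  have "card {v \<in> set (Cs ! i). degree H v = 2} \<le> length vs"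
    using card_length[of vs] by (simp add: vs_def)
  with C(2) have two: "2 \<le> length vs" by simp
  from assms(3) obtain ws xs where
    "length ws = length vs" "length xs = length vs" "distinct (ws @ xs)"
    "set (ws @ xs) \<inter> verts H = {}" "C' = altan.C' ws xs" "S = altan.spokes vs ws"
    "H' = altan.H' H vs ws xs"
    unfolding is_altan_def Let_def vs_def by blast
  moreover from this have "altan H vs ws xs"
    using assms(1) C(1) two by unfold_locales (auto simp: altan_ready_def vs_def)
  ultimately show thesis using that by blast
qed

text \<open>The \<open>xs\<close> are the degree-2 vertices that the new cycle offers, and the new
  cycle shares no vertex with the old ones.\<close>

lemma altan_ready_step:
  assumes ready: "altan_ready H Cs" and i: "i < length Cs" and alt: "is_altan H (Cs ! i) H' C' S"
  shows "altan_ready H' (Cs[i := C'])"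
proof -
  let ?vs = "filter (\<lambda>v. degree H v = 2) (Cs ! i)"
  obtain ws xs where "altan H ?vs ws xs"
    and C': "C' = altan.C' ws xs" and "S = altan.spokes ?vs ws"
    and H': "H' = altan.H' H ?vs ws xs"
    by (rule is_altan_imp_altan[OF ready i alt])
  then interpret altan H ?vs ws xs by simp
  have setC': "set C' = set ws \<union> set xs"
    using set_interleave[of ws xs] len_ws len_xs C' by simp
  have verts': "verts H' = verts H \<union> set C'" using H' setC' by auto
  have edges': "edges H \<union> cycle_edges C' \<subseteq> edges H'" using H' C' by auto
  have disj: "set C' \<inter> verts H = {}" using fresh setC' by auto
  have old: "set (Cs ! j) \<subseteq> verts H" "cycle_edges (Cs ! j) \<subseteq> edges H"
    "2 \<le> card {v \<in> set (Cs ! j). degree H v = 2}" if "j < length Cs" for j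
    using ready that by (auto simp: altan_ready_def)
  have uniq: "j = k" if "j < length Cs" "k < length Cs" "degree H v = 2"
      "v \<in> set (Cs ! j)" "v \<in> set (Cs ! k)" for j k v
    using ready that unfolding altan_ready_def by blast
  \<comment> \<open>No old vertex acquires degree 2: members of \<open>?vs\<close> had it before,
    and all others keep their degree.\<close>
  have deg_back: "degree H v = 2" if "v \<in> verts H" "degree H' v = 2" for v
    using degree_old[OF that(1)] that(2) H' by (cases "v \<in> set ?vs") auto
  have "simple_graph H'" using simple_H' H' by simp
  moreover have "finite (verts H')" using ready H' by (simp add: altan_ready_def)
  moreover have "set (Cs[i := C'] ! j) \<subseteq> verts H' \<and> cycle_edges (Cs[i := C'] ! j) \<subseteq> edges H' \<and>
      2 \<le> card {v \<in> set (Cs[i := C'] ! j). degree H' v = 2}" if j: "j < length Cs" for j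
  proof (cases "j = i")
    case True
    have "set xs \<subseteq> {v \<in> set C'. degree H' v = 2}"
      using degree_x len_xs setC' H' by (auto simp: in_set_conv_nth)
    then have "card (set xs) \<le> card {v \<in> set C'. degree H' v = 2}" by (intro card_mono) auto
    moreover have "card (set xs) = length ?vs" using dist len_xs by (simp add: distinct_card)
    ultimately show ?thesis using True i two verts' edges' by simp
  next
    case False
    \<comment> \<open>The operation changes old degrees only in \<open>?vs\<close>, whose members
      lie on \<open>Cs ! i\<close> and hence, having degree 2, on no other cycle.\<close>
    have "{v \<in> set (Cs ! j). degree H v = 2} \<subseteq> {v \<in> set (Cs ! j). degree H' v = 2}"
    proof clarify
      fix v assume v: "v \<in> set (Cs ! j)" "degree H v = 2"
      then have "v \<notin> set ?vs" using uniq[OF j i] False by auto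
      then show "degree H' v = 2" using degree_old v old(1)[OF j] H' by auto
    qed
    then have "card {v \<in> set (Cs ! j). degree H v = 2} \<le> card {v \<in> set (Cs ! j). degree H' v = 2}"
      by (intro card_mono) auto
    then show ?thesis using False old[OF j] verts' edges' by auto
  qed
  moreover have "j = k" if "j < length Cs" "k < length Cs" "degree H' v = 2"
      "v \<in> set (Cs[i := C'] ! j)" "v \<in> set (Cs[i := C'] ! k)" for j k v
  \<comment> \<open>An old vertex avoids the new cycle, so uniqueness in \<open>H\<close> applies; a
    new vertex can lie only on the cycle at position \<open>i\<close>.\<close>
  proof (cases "v \<in> verts H")
    case True
    then have "j \<noteq> i" "k \<noteq> i" using that disj i by auto
    then show ?thesis using that uniq[of j k v] deg_back[OF True] by simp
  next
    case False
    then have "j = i" "k = i"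
      using that old(1) by (metis nth_list_update_neq subset_iff)+
    then show ?thesis by simp
  qed
  ultimately show ?thesis
    unfolding altan_ready_def all_set_conv_all_nth length_list_update by blast
qed

section \<open>Induction over the altan operations\<close>

text \<open>The claim is strengthened by the invariant and by \<open>S \<subseteq> edges H'\<close>,
  which makes earlier spokes old edges at the next operation. Part (b) is stated without
  division.\<close>

lemma iterated_altan_kekule:
  assumes "iterated_altan H Cs ns H' Cs' S" and "altan_ready H Cs"
  shows "length ns = length Cs \<and> length Cs' = length Cs \<and> altan_ready H' Cs' \<and> S \<subseteq> edges H' \<and>
    card (kekule_structures H') = 2 ^ sum_list ns * card (kekule_structures H) \<and>
    (\<forall>s\<in>S. \<forall>M\<in>kekule_structures H'. s \<notin> M) \<and>
    (\<forall>i<length ns. ns ! i > 0 \<longrightarrow> (\<forall>e\<in>cycle_edges (Cs' ! i).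
       2 * card {M \<in> kekule_structures H'. e \<in> M} = card (kekule_structures H')))"
  using assms
proof induction
  case start
  then show ?case by (simp add: sum_list_replicate)
next
  case (step ns H' Cs' S i H'' C T)
  note IH = step.IH[OF step.prems]
  have i: "i < length Cs'" "i < length ns" using IH step.hyps by auto
  have ready: "altan_ready H' Cs'" using IH by blast
  let ?vs = "filter (\<lambda>v. degree H' v = 2) (Cs' ! i)"
  obtain ws xs where "altan H' ?vs ws xs"
    and C: "C = altan.C' ws xs" and T: "T = altan.spokes ?vs ws"
    and H'': "H'' = altan.H' H' ?vs ws xs"
    by (rule is_altan_imp_altan[OF ready i(1) step.hyps(3)])
  then interpret altan H' ?vs ws xs by simp
  have twice: "card (kekule_structures H'') = 2 * card (kekule_structures H')"
    using card_kekule H'' by simp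
  have "sum_list (ns[i := Suc (ns ! i)]) = Suc (sum_list ns)"
    using i by (simp add: sum_list_update elem_le_sum_list)
  then have "card (kekule_structures H'') =
      2 ^ sum_list (ns[i := Suc (ns ! i)]) * card (kekule_structures H)"
    using twice IH by simp
  moreover have "s \<notin> M" if "s \<in> S \<union> T" "M \<in> kekule_structures H''" for s M
    using that IH new_spoke_unused[of M s] old_edge_unused[of s M] T H'' by blast
  moreover have "S \<union> T \<subseteq> edges H''" using IH T H'' by auto
  moreover have "2 * card {M \<in> kekule_structures H''. e \<in> M} = card (kekule_structures H'')"
    if j: "j < length ns" "ns[i := Suc (ns ! i)] ! j > 0" "e \<in> cycle_edges (Cs'[i := C] ! j)" for j e
  \<comment> \<open>At position \<open>i\<close> the perimeter is new and each edge lies in one of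
    two extensions; at any other position the total and the count for the edge both double, so the
    half persists.\<close>
  proof (cases "j = i")
    case True
    then show ?thesis using twice card_kekule_new_edge[of e] j(3) i C H'' by simp
  next
    case False
    then have "e \<in> cycle_edges (Cs' ! j)" "ns ! j > 0" using j by auto
    moreover from this have "e \<in> edges H'"
      using ready j IH by (auto simp: altan_ready_def)
    ultimately show ?thesis using IH j(1) card_kekule_old_edge[of e] twice H'' by simp
  qed
  moreover have "altan_ready H'' (Cs'[i := C])"
    by (rule altan_ready_step[OF ready i(1) step.hyps(3)])
  moreover have "length (ns[i := Suc (ns ! i)]) = length Cs" "length (Cs'[i := C]) = length Cs"
    using IH by simp_all
  moreover have "length (ns[i := Suc (ns ! i)]) = length ns" by simp
  ultimately show ?case by presburger
qed

section \<open>From perforated patches to the graph statement\<close>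

text \<open>The arc of a boundary edge lies in the frontier of its face and contains both ends of
  the edge, so these are boundary vertices of the same face.\<close>

lemma skeleton_simple_finite:
  assumes "plane_graph G\<^sub>0 \<gamma>"
  shows "simple_graph (skeleton G\<^sub>0 \<gamma> P)" and "finite (verts (skeleton G\<^sub>0 \<gamma> P))"
proof -
  have "e \<subseteq> boundary_verts G\<^sub>0 f" "card e = 2" if "e \<in> boundary_edges G\<^sub>0 \<gamma> f" for e f
  proof -
    have e: "e \<in> edges G\<^sub>0" "path_image (\<gamma> e) \<subseteq> frontier f"
      using that by (auto simp: boundary_edges_def)
    then have "path_image (\<gamma> e) \<inter> verts G\<^sub>0 = e" using assms by (simp add: plane_graph_def)
    then show "e \<subseteq> boundary_verts G\<^sub>0 f" using e(2) unfolding boundary_verts_def by blast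
    show "card e = 2" using e(1) assms by (simp add: plane_graph_def simple_graph_def)
  qed
  then show "simple_graph (skeleton G\<^sub>0 \<gamma> P)"
    unfolding simple_graph_def skeleton_def by fastforce
  have "verts (skeleton G\<^sub>0 \<gamma> P) \<subseteq> verts G\<^sub>0" by (auto simp: skeleton_def boundary_verts_def)
  then show "finite (verts (skeleton G\<^sub>0 \<gamma> P))"
    using assms by (auto simp: plane_graph_def intro: finite_subset)
qed

theorem theorem5p3:
  fixes G\<^sub>0 :: "complex graph" and \<gamma> :: "complex set \<Rightarrow> real \<Rightarrow> complex"
    and P :: "complex set set" and hs :: "complex set set list"
    and Cs Cs' :: "complex list list" and ns :: "nat list"
    and G G' :: "complex graph" and S :: "complex set set" and K K' :: nat
  assumes "plane_graph G\<^sub>0 \<gamma>" and "cubic G\<^sub>0"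
    and "perforated_patch G\<^sub>0 \<gamma> P"
    and "G = skeleton G\<^sub>0 \<gamma> P"
    and "distinct hs" and "set hs = holes G\<^sub>0 \<gamma> P"
    and "length Cs = length hs"
    and "\<forall>i<length hs. cycle_graph (Cs ! i) = perimeter G\<^sub>0 \<gamma> P (hs ! i)"
    and "admissible G Cs"
    and "K = card (kekule_structures G)"
    and "length ns = length hs"
    and "iterated_altan G Cs ns G' Cs' S"
    and "K' = card (kekule_structures G')"
  shows "K' = 2 ^ sum_list ns * K \<and>
         (\<forall>s\<in>S. \<forall>M\<in>kekule_structures G'. s \<notin> M) \<and>
         (\<forall>i<length ns. ns ! i > 0 \<longrightarrow>
            (\<forall>e\<in>cycle_edges (Cs' ! i).
               real (card {M \<in> kekule_structures G'. e \<in> M}) = real K' / 2))"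
proof -
  have "altan_ready G Cs"
    using skeleton_simple_finite[OF assms(1)] assms(4,9) admissible_imp_altan_ready by blast
  note res = iterated_altan_kekule[OF assms(12) this]
  have "real (card {M \<in> kekule_structures G'. e \<in> M}) = real K' / 2"
    if "i < length ns" "ns ! i > 0" "e \<in> cycle_edges (Cs' ! i)" for i e
  proof -
    have "2 * card {M \<in> kekule_structures G'. e \<in> M} = K'" using res that assms(13) by blast
    then show ?thesis by linarith
  qed
  then show ?thesis using res assms(10,13) by blast
qed

end
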